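(* Let $\mathcal{E}=\{\epsilon_p(j),\ j\in[p],\ p\in\mathbb{N}\}$ be a uniformly relatively stable (URS) Gaussian triangular array with standard Normal marginals, and let $u_p=\Phi^{-1}(1-1/p)$. Let $f:\mathbb{R}\to\mathbb{R}$ be a non-decreasing, differentiable and eventually strictly increasing function with $\lim_{x\to\infty}f(x)\neq 0$, whose derivative $f'(x)$ is either eventually increasing or eventually decreasing as $x\to\infty$. Set $\eta_p(j)=f(\epsilon_p(j))$ and $v_p=f(u_p)$. Suppose that $\delta_p>0$, $\delta_p\to0$, is such that $$\mathbb{P}\left(\left|\frac{\max_{j\in[p]}\epsilon_p(j)}{u_p}-1\right|>\delta_p\right)\to 0,\quad\text{as } p\to\infty.$$ Then $$\mathbb{P}\left(\left|\frac{\max_{j\in[p]}\eta_p(j)}{v_p}-1\right|>d_p\right)\to 0,\quad\text{as } p\to\infty,$$ provided that $$d_p\geq d_p^{\star}:=\frac{u_p\delta_p\max\left\{|f'(u_p(1-\delta_p))|,\ |f'(u_p(1+\delta_p))|\right\}}{|f(u_p)|}.$$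
   Context: $[p]=\{1,\dots,p\}$; $\Phi$ is the standard Normal cumulative distribution function. A Gaussian triangular array with standard Normal marginals is a family $\{\epsilon_p(j),\ j\in[p],\ p\in\mathbb{N}\}$ such that, for each $p$, $(\epsilon_p(1),\dots,\epsilon_p(p))$ is jointly Gaussian (with arbitrary dependence) and each $\epsilon_p(j)\sim N(0,1)$. URS (uniform relative stability): for every sequence of subsets $S_p\subseteq\{1,\dots,p\}$ with $|S_p|\to\infty$, one has $\frac{1}{u_{|S_p|}}\max_{i\in S_p}\epsilon_p(i)\to 1$ in probability as $p\to\infty$. "Eventually" means on some half-line $[x_0,\infty)$. The limit $\lim_{x\to\infty}f(x)$ may be $+\infty$. All statements concern sufficiently large $p$, for which $u_p>0$ and $f(u_p)\neq0$. *)

theory Defs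
  imports "HOL-Probability.Probability"
begin

definition std_normal_cdf :: "real \<Rightarrow> real" where
  "std_normal_cdf = cdf std_normal_distribution"

(* std_normal_cdf is a bijection from the reals onto {0<..<1}, so its inverse is meaningful
   exactly there. In particular normal_quantile p is meaningful for p \<ge> 2 only; all uses are
   asymptotic in p. *)
definition normal_quantile :: "nat \<Rightarrow> real" where
  "normal_quantile p = inv std_normal_cdf (1 - 1 / real p)"

(* The degenerate case \<sigma> = 0 is the point mass at \<mu>. *)
definition normal_law :: "real \<Rightarrow> real \<Rightarrow> real measure" where
  "normal_law \<mu> \<sigma> =
     (if \<sigma> = 0 then return borel \<mu> else density lborel (normal_density \<mu> \<sigma>))"

(* All linear combinations are univariate normal, possibly degenerate, so the covariance
   matrix is allowed to be singular. *)
definition jointly_gaussian :: "'a measure \<Rightarrow> 'i set \<Rightarrow> ('i \<Rightarrow> 'a \<Rightarrow> real) \<Rightarrow> bool" where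
  "jointly_gaussian M I X \<longleftrightarrow>
     (\<forall>i\<in>I. X i \<in> borel_measurable M) \<and>
     (\<forall>a :: 'i \<Rightarrow> real. \<exists>\<mu> \<sigma>. \<sigma> \<ge> 0 \<and>
        distr M borel (\<lambda>\<omega>. \<Sum>i\<in>I. a i * X i \<omega>) = normal_law \<mu> \<sigma>)"

definition std_gaussian_array :: "'a measure \<Rightarrow> (nat \<Rightarrow> nat \<Rightarrow> 'a \<Rightarrow> real) \<Rightarrow> bool" where
  "std_gaussian_array M \<epsilon> \<longleftrightarrow>
     (\<forall>p. jointly_gaussian M {1..p} (\<epsilon> p) \<and>
          (\<forall>j\<in>{1..p}. distr M borel (\<epsilon> p j) = std_normal_distribution))"

definition converges_in_prob :: "'a measure \<Rightarrow> (nat \<Rightarrow> 'a \<Rightarrow> real) \<Rightarrow> real \<Rightarrow> bool" where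
  "converges_in_prob M X c \<longleftrightarrow>
     (\<forall>e>0. (\<lambda>p. \<P>(\<omega> in M. \<bar>X p \<omega> - c\<bar> > e)) \<longlonglongrightarrow> 0)"

(* S p may be empty for finitely many p, where Max is unspecified; this does not affect the
   limit. *)
definition uniformly_relatively_stable ::
    "'a measure \<Rightarrow> (nat \<Rightarrow> nat \<Rightarrow> 'a \<Rightarrow> real) \<Rightarrow> bool" where
  "uniformly_relatively_stable M \<epsilon> \<longleftrightarrow>
     (\<forall>S :: nat \<Rightarrow> nat set.
        (\<forall>p. S p \<subseteq> {1..p}) \<longrightarrow>
        filterlim (\<lambda>p. card (S p)) at_top sequentially \<longrightarrow>
        converges_in_prob M
          (\<lambda>p \<omega>. 1 / normal_quantile (card (S p)) * (MAX i\<in>S p. \<epsilon> p i \<omega>)) 1)"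

end

theory Submission
  imports Defs
begin

text \<open>
  The argument is deterministic apart from one inclusion of events. As \<open>f\<close> is non-decreasing,
  it commutes with finite maxima, so the maximum of the transformed row is \<open>f\<close> applied to
  the maximum \<open>m\<close> of the Gaussian row. On the event \<open>\<bar>m / u - 1\<bar> \<le> \<delta>\<close> both \<open>m\<close> and \<open>u\<close> lie in
  \<open>[u (1 - \<delta>), u (1 + \<delta>)]\<close>, and the mean value inequality on this interval bounds
  \<open>\<bar>f m - f u\<bar>\<close> by \<open>u \<delta>\<close> times the supremum of \<open>\<bar>f'\<bar>\<close>. A monotone \<open>f'\<close> takes values between its
  endpoint values, whence the maximum in the formula for \<open>d\<^sup>*\<close>; dividing by \<open>\<bar>f u\<bar>\<close> gives
  \<open>\<bar>f m / f u - 1\<bar> \<le> d\<^sup>* \<le> d\<close> (lemma \<open>relative_error_transfer\<close>). The bad event for the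
  transformed maxima is therefore contained in the bad event for the original ones.

  The interval must lie in the half-line where \<open>f'\<close> is monotone, and \<open>f u\<close> must be nonzero. As
  \<open>\<delta>\<close> tends to 0 and the limit of \<open>f\<close> at infinity is nonzero, both hold for large \<open>p\<close> once
  the quantiles \<open>u\<close> are known to tend to infinity (lemma
  \<open>normal_quantile_at_top\<close>): continuity of \<open>\<Phi>\<close> makes \<open>\<Phi> u = 1 - 1 / p\<close> an equality, and since \<open>\<Phi>\<close>
  never reaches 1, no fixed bound on \<open>u\<close> survives as \<open>1 - 1 / p\<close> tends to 1.
\<close>

lemma std_normal_cdf_mono: "x \<le> y \<Longrightarrow> std_normal_cdf x \<le> std_normal_cdf y"
proof -
  interpret real_distribution std_normal_distribution by (rule real_dist_normal_dist)
  show "x \<le> y \<Longrightarrow> std_normal_cdf x \<le> std_normal_cdf y"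
    unfolding std_normal_cdf_def by (rule cdf_nondecreasing)
qed

lemma isCont_std_normal_cdf: "isCont std_normal_cdf x"
proof -
  interpret real_distribution std_normal_distribution by (rule real_dist_normal_dist)
  have "AE y in lborel. y \<in> {x} \<longrightarrow> ennreal (std_normal_density y) \<le> 0"
    using AE_lborel_singleton[of x] by eventually_elim auto
  then have "emeasure std_normal_distribution {x} = 0"
    by (subst emeasure_density) (auto simp: nn_integral_0_iff_AE split: split_indicator)
  then show ?thesis
    unfolding std_normal_cdf_def isCont_cdf by (simp add: measure_def)
qed

text \<open>The density is positive everywhere, so a Gaussian variable is not bounded above almost
  surely: otherwise a half-line would be a Lebesgue null set.\<close>
lemma std_normal_cdf_less_1: "std_normal_cdf x < 1"
proof -
  interpret real_distribution std_normal_distribution by (rule real_dist_normal_dist)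
  have "std_normal_cdf x \<noteq> 1"
  proof
    assume "std_normal_cdf x = 1"
    then have "prob {..x} = 1"
      by (simp add: std_normal_cdf_def cdf_def)
    then have "AE y in std_normal_distribution. y \<in> {..x}"
      by (subst (asm) prob_eq_1) auto
    then have "AE y in lborel. y \<in> {..x}"
      by (subst (asm) AE_density) (auto simp: normal_density_pos)
    then have "emeasure lborel {x<..} = 0"
      by (subst (asm) AE_iff_measurable[of "{x<..}"]) auto
    moreover have "emeasure lborel {x<..<x+1} \<le> emeasure lborel {x<..}"
      by (rule emeasure_mono) auto
    ultimately show False by simp
  qed
  moreover have "std_normal_cdf x \<le> 1"
    unfolding std_normal_cdf_def by (rule cdf_bounded_prob)
  ultimately show ?thesis by simp
qed

lemma std_normal_cdf_quantile:
  assumes "p \<ge> 2"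
  shows "std_normal_cdf (normal_quantile p) = 1 - 1 / real p"
proof -
  interpret real_distribution std_normal_distribution by (rule real_dist_normal_dist)
  let ?q = "1 - 1 / real p"
  have q: "0 < ?q" "?q < 1"
    using assms by (auto simp: field_simps)
  have "\<forall>\<^sub>F x in at_bot. std_normal_cdf x < ?q"
    unfolding std_normal_cdf_def by (rule order_tendstoD(2)[OF cdf_lim_at_bot q(1)])
  then obtain a where a: "\<And>x. x \<le> a \<Longrightarrow> std_normal_cdf x < ?q"
    by (auto simp: eventually_at_bot_linorder)
  have "\<forall>\<^sub>F x in at_top. std_normal_cdf x > ?q"
    unfolding std_normal_cdf_def by (rule order_tendstoD(1)[OF cdf_lim_at_top_prob q(2)])
  then obtain b where b: "\<And>x. x \<ge> b \<Longrightarrow> std_normal_cdf x > ?q"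
    by (auto simp: eventually_at_top_linorder)
  have "\<exists>x\<ge>a. x \<le> max a b \<and> std_normal_cdf x = ?q"
    using a[of a] b[of "max a b"]
    by (intro IVT) (auto simp: isCont_std_normal_cdf)
  then have "?q \<in> range std_normal_cdf" by (metis rangeI)
  then show ?thesis
    unfolding normal_quantile_def by (rule f_inv_into_f)
qed

lemma normal_quantile_at_top: "filterlim normal_quantile at_top sequentially"
  unfolding filterlim_at_top
proof
  fix x :: real
  have "(\<lambda>p. 1 - 1 / real p) \<longlonglongrightarrow> 1 - 0"
    by (intro tendsto_intros lim_1_over_n)
  then have "\<forall>\<^sub>F p in sequentially. std_normal_cdf x < 1 - 1 / real p"
    using std_normal_cdf_less_1[of x] by (intro order_tendstoD(1)) auto
  then show "\<forall>\<^sub>F p in sequentially. x \<le> normal_quantile p"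
    using eventually_ge_at_top[of 2]
  proof eventually_elim
    case (elim p)
    then have "std_normal_cdf x < std_normal_cdf (normal_quantile p)"
      by (simp add: std_normal_cdf_quantile)
    then show ?case
      using std_normal_cdf_mono by (meson linear not_le)
  qed
qed

lemma abs_le_max_endpoints_if_monotone:
  fixes g :: "real \<Rightarrow> real"
  assumes "mono_on A g \<or> antimono_on A g" "a \<in> A" "x \<in> A" "b \<in> A" "a \<le> x" "x \<le> b"
  shows "\<bar>g x\<bar> \<le> max \<bar>g a\<bar> \<bar>g b\<bar>"
  using assms(1)
proof
  assume "mono_on A g"
  then have "g a \<le> g x" "g x \<le> g b"
    using assms by (auto intro: mono_onD)
  then show ?thesis by linarith
next
  assume "antimono_on A g"
  then have "g x \<le> g a" "g b \<le> g x"
    using assms by (auto dest: monotone_onD)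
  then show ?thesis by linarith
qed

text \<open>The mean value inequality on the interval of relative radius \<open>\<delta>\<close> about \<open>u\<close>, in
  which the monotonicity of the derivative replaces its supremum by the larger endpoint value.\<close>
lemma relative_error_transfer:
  fixes f :: "real \<Rightarrow> real"
  assumes diff: "\<forall>x. f differentiable (at x)"
    and monotone: "mono_on {x0..} (deriv f) \<or> antimono_on {x0..} (deriv f)"
    and "u > 0" "x0 \<le> u * (1 - \<delta>)" "f u \<noteq> 0"
    and close: "\<bar>m / u - 1\<bar> \<le> \<delta>"
  shows "\<bar>f m / f u - 1\<bar>
           \<le> u * \<delta> * max \<bar>deriv f (u * (1 - \<delta>))\<bar> \<bar>deriv f (u * (1 + \<delta>))\<bar> / \<bar>f u\<bar>"
proof -
  let ?a = "u * (1 - \<delta>)" and ?b = "u * (1 + \<delta>)"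
  let ?B = "max \<bar>deriv f ?a\<bar> \<bar>deriv f ?b\<bar>"
  have "m / u - 1 = (m - u) / u"
    using \<open>u > 0\<close> by (simp add: field_simps)
  then have dist: "\<bar>m - u\<bar> \<le> u * \<delta>"
    using close \<open>u > 0\<close> by (simp add: abs_divide pos_divide_le_eq mult.commute)
  then have mem: "m \<in> {?a..?b}" "u \<in> {?a..?b}"
    by (auto simp: algebra_simps)
  have "norm (f m - f u) \<le> ?B * norm (m - u)"
  proof (rule field_differentiable_bound[where S = "{?a..?b}" and f' = "deriv f"])
    fix z assume z: "z \<in> {?a..?b}"
    have "(f has_real_derivative deriv f z) (at z)"
      using diff by (simp add: DERIV_deriv_iff_real_differentiable)
    then show "(f has_field_derivative deriv f z) (at z within {?a..?b})"
      by (rule has_field_derivative_at_within)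
    show "norm (deriv f z) \<le> ?B"
      using abs_le_max_endpoints_if_monotone[OF monotone, of ?a z ?b] z \<open>x0 \<le> ?a\<close> by auto
  qed (use mem in auto)
  also have "\<dots> \<le> ?B * (u * \<delta>)"
    using dist by (intro mult_left_mono) auto
  finally have "\<bar>f m - f u\<bar> / \<bar>f u\<bar> \<le> u * \<delta> * ?B / \<bar>f u\<bar>"
    by (intro divide_right_mono) (auto simp: mult_ac)
  moreover have "f m / f u - 1 = (f m - f u) / f u"
    using \<open>f u \<noteq> 0\<close> by (simp add: field_simps)
  ultimately show ?thesis
    by (simp add: abs_divide)
qed

theorem proposition4p1:
  fixes M :: "'a measure"
    and \<epsilon> :: "nat \<Rightarrow> nat \<Rightarrow> 'a \<Rightarrow> real"
    and f :: "real \<Rightarrow> real"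
    and L :: ereal
    and u v \<delta> d :: "nat \<Rightarrow> real"
    and \<eta> :: "nat \<Rightarrow> nat \<Rightarrow> 'a \<Rightarrow> real"
  assumes "prob_space M"
    and "std_gaussian_array M \<epsilon>"
    and "uniformly_relatively_stable M \<epsilon>"
    and u_def: "u = normal_quantile"
    and "mono f"
    and "\<forall>x. f differentiable (at x)"
    and "\<exists>x0. strict_mono_on {x0..} f"
    and "((\<lambda>x. ereal (f x)) \<longlongrightarrow> L) at_top"
    and "L \<noteq> 0"
    and "(\<exists>x0. mono_on {x0..} (deriv f)) \<or> (\<exists>x0. antimono_on {x0..} (deriv f))"
    and eta_def: "\<eta> = (\<lambda>p j \<omega>. f (\<epsilon> p j \<omega>))"
    and v_def: "v = (\<lambda>p. f (u p))"
    and "\<forall>\<^sub>F p in sequentially. \<delta> p > 0"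
    and "\<delta> \<longlonglongrightarrow> 0"
    and "(\<lambda>p. \<P>(\<omega> in M. \<bar>(MAX j\<in>{1..p}. \<epsilon> p j \<omega>) / u p - 1\<bar> > \<delta> p)) \<longlonglongrightarrow> 0"
    and "\<forall>\<^sub>F p in sequentially.
           d p \<ge> u p * \<delta> p * max \<bar>deriv f (u p * (1 - \<delta> p))\<bar> \<bar>deriv f (u p * (1 + \<delta> p))\<bar>
                  / \<bar>f (u p)\<bar>"
  shows "(\<lambda>p. \<P>(\<omega> in M. \<bar>(MAX j\<in>{1..p}. \<eta> p j \<omega>) / v p - 1\<bar> > d p)) \<longlonglongrightarrow> 0"
proof -
  interpret prob_space M by fact
  obtain x0 where x0: "mono_on {x0..} (deriv f) \<or> antimono_on {x0..} (deriv f)"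
    using assms(10) by blast
  have u_top: "filterlim u at_top sequentially"
    unfolding u_def by (rule normal_quantile_at_top)
  have "(\<lambda>p. 1 - \<delta> p) \<longlonglongrightarrow> 1 - 0"
    by (intro tendsto_intros assms(14))
  then have "filterlim (\<lambda>p. (1 - \<delta> p) * u p) at_top sequentially"
    by (rule filterlim_tendsto_pos_mult_at_top[OF _ _ u_top]) simp
  then have left_end: "\<forall>\<^sub>F p in sequentially. x0 \<le> u p * (1 - \<delta> p)"
    by (simp add: filterlim_at_top mult.commute)
  have u_pos: "\<forall>\<^sub>F p in sequentially. 0 < u p"
    using u_top by (auto simp: filterlim_at_top_dense)
  have "\<forall>\<^sub>F x in at_top. ereal (f x) \<noteq> 0"
    using assms(8,9) by (rule tendsto_imp_eventually_ne)
  then have f_nz: "\<forall>\<^sub>F p in sequentially. f (u p) \<noteq> 0"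
    using u_top by (auto dest: eventually_compose_filterlim)
  let ?bad_eta = "\<lambda>p. \<P>(\<omega> in M. \<bar>(MAX j\<in>{1..p}. \<eta> p j \<omega>) / v p - 1\<bar> > d p)"
  let ?bad_eps = "\<lambda>p. \<P>(\<omega> in M. \<bar>(MAX j\<in>{1..p}. \<epsilon> p j \<omega>) / u p - 1\<bar> > \<delta> p)"
  have "\<forall>\<^sub>F p in sequentially. ?bad_eta p \<le> ?bad_eps p"
    using left_end u_pos f_nz assms(16) eventually_ge_at_top[of 1]
  proof eventually_elim
    case (elim p)
    have [measurable]: "\<And>j. j \<in> {1..p} \<Longrightarrow> \<epsilon> p j \<in> borel_measurable M"
      using assms(2) by (auto simp: std_gaussian_array_def jointly_gaussian_def)
    have [measurable]: "(\<lambda>\<omega>. MAX j\<in>{1..p}. \<epsilon> p j \<omega>) \<in> borel_measurable M"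
      by (rule borel_measurable_Max) auto
    have max_eta: "(MAX j\<in>{1..p}. \<eta> p j \<omega>) = f (MAX j\<in>{1..p}. \<epsilon> p j \<omega>)" for \<omega>
      using mono_Max_commute[OF \<open>mono f\<close>, of "(\<lambda>j. \<epsilon> p j \<omega>) ` {1..p}"] elim(5)
      by (simp add: eta_def image_image)
    show ?case
    proof (rule finite_measure_mono)
      show "{\<omega> \<in> space M. \<bar>(MAX j\<in>{1..p}. \<eta> p j \<omega>) / v p - 1\<bar> > d p}
          \<subseteq> {\<omega> \<in> space M. \<bar>(MAX j\<in>{1..p}. \<epsilon> p j \<omega>) / u p - 1\<bar> > \<delta> p}"
      proof safe
        fix \<omega> assume far: "\<bar>(MAX j\<in>{1..p}. \<eta> p j \<omega>) / v p - 1\<bar> > d p"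
        show "\<bar>(MAX j\<in>{1..p}. \<epsilon> p j \<omega>) / u p - 1\<bar> > \<delta> p"
        proof (rule ccontr)
          assume "\<not> ?thesis"
          then have "\<bar>f (MAX j\<in>{1..p}. \<epsilon> p j \<omega>) / f (u p) - 1\<bar> \<le> d p"
            using relative_error_transfer[OF assms(6) x0 elim(2,1,3)] elim(4)
            by (meson not_le order_trans)
          with far show False
            unfolding max_eta v_def by linarith
        qed
      qed
    qed measurable
  qed
  then show ?thesis
    by (intro tendsto_sandwich[OF _ _ tendsto_const assms(15)]) auto
qed

end
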